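(* For the random walk on $\mathbb{Z}_{c^{n-1}}$ determined by the sequence $\{c^{n-1}\}_{n\ge 1}$, where $c>1$ is an integer, $$t_{mix}(\epsilon)\ge(\gamma n-1)\log\left(\frac{1}{2\epsilon}\right),\qquad\text{where } \gamma=\frac{1}{1-\cos(2\pi/c)}.$$
   Context: Put $G_n=c^{n-1}$. For fixed $n$, the random walk determined by the sequence is the Markov chain $(X_t)_{t\ge 0}$ on $\mathbb{Z}_{G_n}=\mathbb{Z}/G_n\mathbb{Z}$ with $X_0=0$ and $X_{t+1}\equiv X_t+z_t\pmod{G_n}$, where each $z_t$ is chosen uniformly at random (independently at each step) from $\{G_1,\dots,G_n\}=\{1,c,\dots,c^{n-1}\}$. Let $P_0^t$ be the distribution of $X_t$ and $\pi$ the uniform distribution on $\mathbb{Z}_{G_n}$, which is the stationary distribution. The total variation distance between probability distributions on a finite set $S$ is $\|\mu-\eta\|_{TV}=\frac12\sum_{x\in S}|\mu(x)-\eta(x)|$. The mixing time is $t_{mix}(\epsilon)=\min\{t:\|P_0^t-\pi\|_{TV}\le\epsilon\}$. Here $\log$ is the natural logarithm.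
   Formalization: The bound is stated for n ≥ 2; for n = 1 the group is trivial and the mixing time is 0, so the claim fails, e.g. for c = 5 and ε = 1/8, where the right-hand side is about 0.62. *)

theory Defs
  imports "HOL-Probability.Probability_Mass_Function"
begin

text \<open>
  A sequence is a function \<open>G :: nat \<Rightarrow> nat\<close> whose terms are \<open>G 1, G 2, \<dots>\<close>;
  the value \<open>G 0\<close> is never used. The group of integers modulo \<open>G n\<close> is represented by the
  least residues \<open>{0..<G n}\<close>.
\<close>

definition walk_states :: "(nat \<Rightarrow> nat) \<Rightarrow> nat \<Rightarrow> nat set" where
  "walk_states G n = {0..<G n}"

definition walk_step :: "(nat \<Rightarrow> nat) \<Rightarrow> nat \<Rightarrow> nat \<Rightarrow> nat pmf" where
  "walk_step G n x = map_pmf (\<lambda>z. (x + z) mod G n) (pmf_of_set (G ` {1..n}))"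

text \<open>The distribution of \<open>X\<^sub>t\<close> for the Markov chain started at \<open>X\<^sub>0 = 0\<close>; binding with the
  kernel draws each increment independently of the past.\<close>

primrec walk_dist :: "(nat \<Rightarrow> nat) \<Rightarrow> nat \<Rightarrow> nat \<Rightarrow> nat pmf" where
  "walk_dist G n 0 = return_pmf 0"
| "walk_dist G n (Suc t) = bind_pmf (walk_dist G n t) (walk_step G n)"

definition tv_dist :: "'a set \<Rightarrow> 'a pmf \<Rightarrow> 'a pmf \<Rightarrow> real" where
  "tv_dist S \<mu> \<eta> = (1 / 2) * (\<Sum>x\<in>S. \<bar>pmf \<mu> x - pmf \<eta> x\<bar>)"

text \<open>\<open>LEAST\<close> is the minimum only if some \<open>t\<close> satisfies the bound; it is unspecified otherwise.\<close>

definition mixing_time :: "(nat \<Rightarrow> nat) \<Rightarrow> nat \<Rightarrow> real \<Rightarrow> nat" where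
  "mixing_time G n \<epsilon> =
     (LEAST t. tv_dist (walk_states G n) (walk_dist G n t) (pmf_of_set (walk_states G n)) \<le> \<epsilon>)"

end

theory Submission
  imports Defs
begin

text \<open>
  The walk adds independent increments, so the characters \<open>x \<mapsto> \<omega> ^ x\<close>, \<open>\<omega> ^ N = 1\<close>, of the group
  of integers modulo \<open>N = c ^ (n - 1)\<close> are eigenfunctions of its transition operator: the character
  with index \<open>k\<close> has as eigenvalue \<open>\<lambda>\<^sub>k\<close> its average over the increments, and the \<open>k\<close>-th Fourier
  coefficient of the distribution at time \<open>t\<close> is \<open>\<lambda>\<^sub>k ^ t\<close> (\<open>fourier_coeff_walk_dist\<close>). A character
  with \<open>0 < k < N\<close> has mean zero under the uniform distribution and modulus one, so
  \<open>\<bar>\<lambda>\<^sub>k\<bar> ^ t\<close> is at most twice the total variation distance (\<open>norm_fourier_coeff_le_tv_dist\<close>).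

  For \<open>k = c ^ (n - 2)\<close> we have \<open>\<omega> = exp (2 \<pi> i / c)\<close>, and this character is \<open>1\<close> at every increment
  except \<open>1\<close> itself. Hence \<open>\<lambda>\<^sub>k = (\<omega> + n - 1) / n\<close>, whose real part is \<open>1 - 1 / (\<gamma> n)\<close>
  (\<open>Re_walk_eigenvalue_powers\<close>). So \<open>(1 - 1 / (\<gamma> n)) ^ t \<le> 2 \<epsilon>\<close> at the mixing time \<open>t\<close>, and the
  inequality \<open>ln y \<le> y - 1\<close> turns this into the claimed bound (\<open>relaxation_time_bound\<close>).

  The mixing time is a \<open>LEAST\<close>, so the distance is known to be at most \<open>\<epsilon>\<close> there only once some
  time has this property. This is why convergence to the uniform distribution is proved as well
  (\<open>tv_dist_walk_dist_tendsto_0\<close>). Among the increments are \<open>1\<close> and \<open>N\<close>, that is, \<open>1\<close> and \<open>0\<close> modulo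
  \<open>N\<close>. A nontrivial character takes different values there, so its eigenvalue has modulus below one,
  and Fourier inversion shows that every point probability tends to \<open>1 / N\<close>.
\<close>

section \<open>Characters of the cyclic group\<close>

definition unity_root :: "nat \<Rightarrow> nat \<Rightarrow> complex" where
  "unity_root N k = cis (2 * pi * real k / real N)"

lemma norm_unity_root [simp]: "norm (unity_root N k) = 1"
  by (simp add: unity_root_def)

lemma unity_root_neq_0 [simp]: "unity_root N k \<noteq> 0"
  by (simp add: unity_root_def)

lemma unity_root_0 [simp]: "unity_root N 0 = 1"
  by (simp add: unity_root_def)

lemma unity_root_power: "unity_root N k ^ j = unity_root N (k * j)"
  by (simp add: unity_root_def Complex.DeMoivre algebra_simps)

lemma unity_root_power_order:
  assumes "N > 0"
  shows "unity_root N k ^ N = 1"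
  using assms cis_multiple_2pi[of "real k"] by (simp add: unity_root_def Complex.DeMoivre)

lemma unity_root_power_mod:
  assumes "N > 0"
  shows "unity_root N k ^ (x mod N) = unity_root N k ^ x"
proof -
  have "unity_root N k ^ x = unity_root N k ^ (N * (x div N) + x mod N)"
    by simp
  also have "\<dots> = unity_root N k ^ (x mod N)"
    unfolding power_add power_mult using unity_root_power_order[OF assms] by simp
  finally show ?thesis ..
qed

lemma inj_on_unity_root:
  assumes "N > 0"
  shows "inj_on (unity_root N) {..<N}"
  using Complex.bij_betw_roots_unity[OF assms] by (simp add: bij_betw_def inj_on_def unity_root_def)

lemma unity_root_neq_1:
  assumes "0 < k" "k < N"
  shows "unity_root N k \<noteq> 1"
  using inj_onD[OF inj_on_unity_root, of N k 0] assms by auto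

lemma sum_powers_of_unity_eq_0:
  fixes w :: complex
  assumes "w ^ N = 1" "w \<noteq> 1"
  shows "(\<Sum>j<N. w ^ j) = 0"
  using assms by (simp add: geometric_sum)

text \<open>
  The sum runs over the index of the character. Since the pairing \<open>(k, x) \<mapsto> unity_root N k ^ x\<close> is
  symmetric, the summand is the \<open>k\<close>-th power of \<open>unity_root N x / unity_root N y\<close>, and the powers of
  an \<open>N\<close>-th root of unity other than \<open>1\<close> add up to zero.
\<close>

lemma unity_root_dual_orthogonality:
  assumes "x < N" "y < N"
  shows "(\<Sum>k<N. unity_root N k ^ x / unity_root N k ^ y) = (if x = y then of_nat N else 0)"
proof (cases "x = y")
  case False
  define w where "w = unity_root N x / unity_root N y"
  have "w \<noteq> 1"
    using inj_onD[OF inj_on_unity_root, of N x y] assms False by (auto simp: w_def)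
  moreover have "w ^ N = 1"
    using assms by (simp add: w_def power_divide unity_root_power_order)
  moreover have "unity_root N k ^ x / unity_root N k ^ y = w ^ k" for k
    by (simp add: w_def power_divide unity_root_power mult.commute)
  ultimately show ?thesis
    using False by (simp add: sum_powers_of_unity_eq_0)
qed simp

section \<open>Fourier coefficients of a distribution on least residues\<close>

definition fourier_coeff :: "nat \<Rightarrow> nat pmf \<Rightarrow> nat \<Rightarrow> complex" where
  "fourier_coeff N p k = measure_pmf.expectation p (\<lambda>x. unity_root N k ^ x)"

lemma fourier_coeff_eq_sum:
  assumes "set_pmf p \<subseteq> {0..<N}"
  shows "fourier_coeff N p k = (\<Sum>x<N. of_real (pmf p x) * unity_root N k ^ x)"
  unfolding fourier_coeff_def
  by (subst integral_measure_pmf[of "{..<N}"]) (use assms in \<open>auto simp: scaleR_conv_of_real\<close>)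

lemma fourier_inversion:
  assumes "set_pmf p \<subseteq> {0..<N}" "y < N"
  shows "of_real (pmf p y) = (\<Sum>k<N. fourier_coeff N p k / unity_root N k ^ y) / of_nat N"
proof -
  have "(\<Sum>k<N. fourier_coeff N p k / unity_root N k ^ y)
      = (\<Sum>k<N. \<Sum>x<N. of_real (pmf p x) * (unity_root N k ^ x / unity_root N k ^ y))"
    by (simp add: fourier_coeff_eq_sum[OF assms(1)] sum_divide_distrib)
  also have "\<dots> = (\<Sum>x<N. of_real (pmf p x) * (\<Sum>k<N. unity_root N k ^ x / unity_root N k ^ y))"
    by (subst sum.swap) (simp add: sum_distrib_left)
  also have "\<dots> = (\<Sum>x<N. if x = y then of_real (pmf p x) * of_nat N else 0)"
    by (intro sum.cong refl) (simp add: unity_root_dual_orthogonality assms(2))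
  also have "\<dots> = of_real (pmf p y) * of_nat N"
    using assms(2) by simp
  finally show ?thesis
    using assms(2) by simp
qed

text \<open>
  A nontrivial character has mean zero under the uniform distribution, so the coefficient does not
  change when \<open>1 / N\<close> is subtracted from each probability; the triangle inequality then gives the
  \<open>L\<^sup>1\<close> distance.
\<close>

lemma norm_fourier_coeff_le_tv_dist:
  assumes "set_pmf p \<subseteq> {0..<N}" "0 < k" "k < N"
  shows "norm (fourier_coeff N p k) \<le> 2 * tv_dist {0..<N} p (pmf_of_set {0..<N})"
proof -
  let ?w = "unity_root N k" and ?u = "pmf_of_set {0..<N}"
  have u: "pmf ?u x = 1 / real N" if "x < N" for x
    using assms that by (subst pmf_of_set) auto
  have "(\<Sum>x<N. ?w ^ x) = 0"
    using assms by (intro sum_powers_of_unity_eq_0 unity_root_power_order unity_root_neq_1) auto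
  hence "(\<Sum>x<N. of_real (1 / real N) * ?w ^ x) = 0"
    unfolding sum_distrib_left[symmetric] by simp
  hence "fourier_coeff N p k = (\<Sum>x<N. of_real (pmf p x - 1 / real N) * ?w ^ x)"
    unfolding fourier_coeff_eq_sum[OF assms(1)] of_real_diff left_diff_distrib sum_subtractf
    by simp
  hence "norm (fourier_coeff N p k) \<le> (\<Sum>x<N. norm (of_real (pmf p x - 1 / real N) * ?w ^ x))"
    by (simp only: norm_sum)
  also have "\<dots> = (\<Sum>x<N. \<bar>pmf p x - pmf ?u x\<bar>)"
    by (intro sum.cong refl)
       (simp only: norm_mult norm_power norm_of_real norm_unity_root u lessThan_iff power_one mult_1_right)
  finally show ?thesis
    by (simp add: tv_dist_def atLeast0LessThan)
qed

section \<open>Spectrum of the walk\<close>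

definition walk_eigenvalue :: "(nat \<Rightarrow> nat) \<Rightarrow> nat \<Rightarrow> nat \<Rightarrow> complex" where
  "walk_eigenvalue G n k =
     (\<Sum>z\<in>G ` {1..n}. unity_root (G n) k ^ z) / of_nat (card (G ` {1..n}))"

lemma set_pmf_walk_dist:
  assumes "G n > 0"
  shows "set_pmf (walk_dist G n t) \<subseteq> {0..<G n}"
  using assms by (induction t) (auto simp: walk_step_def)

text \<open>
  Characters are eigenfunctions of the transition operator: reduction modulo \<open>G n\<close> does not affect
  them, and they turn the sum \<open>x + z\<close> into a product.
\<close>

lemma fourier_coeff_walk_step:
  assumes "n \<ge> 1" "G n > 0"
  shows "fourier_coeff (G n) (walk_step G n x) k = unity_root (G n) k ^ x * walk_eigenvalue G n k"
proof -
  let ?S = "G ` {1..n}" and ?w = "unity_root (G n) k"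
  have S: "?S \<noteq> {}" "finite ?S"
    using assms by auto
  have "fourier_coeff (G n) (walk_step G n x) k
      = measure_pmf.expectation (pmf_of_set ?S) (\<lambda>z. ?w ^ (x + z))"
    by (simp add: fourier_coeff_def walk_step_def unity_root_power_mod assms)
  also have "\<dots> = (\<Sum>z\<in>?S. ?w ^ (x + z) / of_nat (card ?S))"
    by (subst integral_measure_pmf[of ?S])
       (use S in \<open>auto simp: pmf_of_set scaleR_conv_of_real field_simps\<close>)
  also have "\<dots> = ?w ^ x * walk_eigenvalue G n k"
    by (simp add: walk_eigenvalue_def power_add sum_distrib_left sum_divide_distrib)
  finally show ?thesis .
qed

lemma fourier_coeff_walk_dist:
  assumes "n \<ge> 1" "G n > 0"
  shows "fourier_coeff (G n) (walk_dist G n t) k = walk_eigenvalue G n k ^ t"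
proof (induction t)
  case 0
  show ?case
    by (subst fourier_coeff_eq_sum)
       (use assms in \<open>auto simp: indicator_def of_bool_def if_distribR if_distrib cong: if_cong\<close>)
next
  case (Suc t)
  let ?p = "walk_dist G n t"
  have fin: "finite (set_pmf (walk_step G n x))" for x
    using assms by (auto simp: walk_step_def)
  have "fourier_coeff (G n) (walk_dist G n (Suc t)) k
      = (\<Sum>x<G n. pmf ?p x *\<^sub>R fourier_coeff (G n) (walk_step G n x) k)"
    unfolding fourier_coeff_def walk_dist.simps
    using set_pmf_walk_dist[of G n t] assms(2) fin
    by (intro pmf_expectation_bind) auto
  also have "\<dots> = fourier_coeff (G n) ?p k * walk_eigenvalue G n k"
    using set_pmf_walk_dist[of G n t] assms
    by (simp add: fourier_coeff_walk_step fourier_coeff_eq_sum sum_distrib_right scaleR_conv_of_real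
        mult.assoc)
  finally show ?case
    using Suc by simp
qed

section \<open>Convergence to the uniform distribution\<close>

lemma norm_one_plus_unimodular_less_2:
  fixes w :: complex
  assumes "norm w = 1" "w \<noteq> 1"
  shows "norm (1 + w) < 2"
proof -
  have sq: "(Re w)\<^sup>2 + (Im w)\<^sup>2 = 1"
    using assms(1) cmod_power2[of w] by simp
  hence "Re w \<noteq> 1"
    using assms(2) by (auto simp: complex_eq_iff)
  moreover have "Re w \<le> 1"
    using complex_Re_le_cmod[of w] assms(1) by simp
  moreover have "(norm (1 + w))\<^sup>2 = 2 + 2 * Re w"
    unfolding cmod_power2 using sq by (simp add: power2_eq_square algebra_simps)
  ultimately have "(norm (1 + w))\<^sup>2 < 2\<^sup>2"
    by simp
  thus ?thesis
    by (rule power2_less_imp_less) simp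
qed

text \<open>
  The increment \<open>G n\<close> keeps the walk in place, so the increments \<open>1\<close> and \<open>G n\<close> together contribute
  \<open>\<omega> + 1\<close> to the sum that defines the eigenvalue. This has modulus strictly below two for \<open>\<omega> \<noteq> 1\<close>,
  while each of the remaining increments contributes modulus one.
\<close>

lemma norm_walk_eigenvalue_less_1:
  assumes "n \<ge> 1" "1 \<in> G ` {1..n}" "0 < k" "k < G n"
  shows "norm (walk_eigenvalue G n k) < 1"
proof -
  let ?S = "G ` {1..n}" and ?w = "unity_root (G n) k"
  let ?R = "?S - {1, G n}"
  have G: "G n \<noteq> 1" "G n > 0" "G n \<in> ?S"
    using assms by auto
  have S: "?S = {1, G n} \<union> ?R"
    using assms(2) G(3) by blast
  have card: "card ?S = 2 + card ?R"
    by (subst S, subst card_Un_disjoint) (use G in auto)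
  have "(\<Sum>z\<in>?S. ?w ^ z) = (\<Sum>z\<in>{1, G n}. ?w ^ z) + (\<Sum>z\<in>?R. ?w ^ z)"
    by (subst S, subst sum.union_disjoint) auto
  also have "(\<Sum>z\<in>{1, G n}. ?w ^ z) = 1 + ?w"
    using G by (simp add: unity_root_power_order)
  finally have "norm (\<Sum>z\<in>?S. ?w ^ z) \<le> norm (1 + ?w) + norm (\<Sum>z\<in>?R. ?w ^ z)"
    using norm_triangle_ineq by metis
  also have "norm (\<Sum>z\<in>?R. ?w ^ z) \<le> card ?R"
    using sum_norm_le[of ?R "\<lambda>z. ?w ^ z" "\<lambda>_. 1"] by (simp add: norm_power)
  also have "norm (1 + ?w) < 2"
    using assms by (intro norm_one_plus_unimodular_less_2 unity_root_neq_1) auto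
  finally have "norm (\<Sum>z\<in>?S. ?w ^ z) < card ?S"
    unfolding card by simp
  thus ?thesis
    unfolding walk_eigenvalue_def norm_divide norm_of_nat by (simp add: divide_less_eq)
qed

text \<open>
  In the inversion formula for the distribution at time \<open>t\<close>, the coefficient with index \<open>0\<close> is
  constantly \<open>1\<close> and all others are powers of numbers inside the unit disc, so each point
  probability tends to \<open>1 / G n\<close>.
\<close>

lemma tv_dist_walk_dist_tendsto_0:
  assumes "n \<ge> 1" "1 \<in> G ` {1..n}" "G n > 0"
  shows "(\<lambda>t. tv_dist (walk_states G n) (walk_dist G n t) (pmf_of_set (walk_states G n)))
           \<longlonglongrightarrow> 0"
proof -
  let ?N = "G n"
  have ev0: "walk_eigenvalue G n 0 = 1"
    using assms(2) by (auto simp: walk_eigenvalue_def)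
  have "(\<lambda>t. pmf (walk_dist G n t) y) \<longlonglongrightarrow> 1 / real ?N" if y: "y < ?N" for y
  proof -
    have "(\<lambda>t. walk_eigenvalue G n k ^ t) \<longlonglongrightarrow> (if k = 0 then 1 else 0)" if "k < ?N" for k
      using that ev0 norm_walk_eigenvalue_less_1[OF assms(1,2), of k]
      by (auto intro!: LIMSEQ_power_zero)
    hence "(\<lambda>t. (\<Sum>k<?N. walk_eigenvalue G n k ^ t / unity_root ?N k ^ y) / of_nat ?N)
        \<longlonglongrightarrow> (\<Sum>k<?N. (if k = 0 then 1 else 0) / unity_root ?N k ^ y) / of_nat ?N"
      using assms(3) by (intro tendsto_intros) auto
    also have "(\<Sum>k<?N. (if k = 0 then 1 else 0) / unity_root ?N k ^ y)
        = (\<Sum>k<?N. if k = 0 then 1 else 0)"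
      by (intro sum.cong) auto
    also have "\<dots> = 1"
      using assms(3) by simp
    finally have "(\<lambda>t. complex_of_real (pmf (walk_dist G n t) y)) \<longlonglongrightarrow> of_real (1 / real ?N)"
      using fourier_inversion[OF set_pmf_walk_dist[of G n, OF assms(3)] y]
      by (simp add: fourier_coeff_walk_dist[of n G, OF assms(1,3)])
    thus ?thesis
      by (simp only: tendsto_of_real_iff)
  qed
  hence "(\<lambda>t. pmf (walk_dist G n t) y - pmf (pmf_of_set {0..<?N}) y) \<longlonglongrightarrow> 0"
    if "y < ?N" for y
    using that by (subst pmf_of_set) (auto intro: LIM_zero)
  hence "(\<lambda>t. (1 / 2) * (\<Sum>y\<in>{0..<?N}.
            \<bar>pmf (walk_dist G n t) y - pmf (pmf_of_set {0..<?N}) y\<bar>)) \<longlonglongrightarrow> (1 / 2) * (\<Sum>y\<in>{0..<?N}. 0)"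
    by (intro tendsto_intros tendsto_rabs_zero) auto
  thus ?thesis
    by (simp add: tv_dist_def walk_states_def)
qed

lemma tv_dist_mixing_time_le:
  assumes "n \<ge> 1" "1 \<in> G ` {1..n}" "G n > 0" "\<epsilon> > 0"
  shows "tv_dist (walk_states G n) (walk_dist G n (mixing_time G n \<epsilon>))
           (pmf_of_set (walk_states G n)) \<le> \<epsilon>"
proof -
  have "\<forall>\<^sub>F t in sequentially.
      tv_dist (walk_states G n) (walk_dist G n t) (pmf_of_set (walk_states G n)) < \<epsilon>"
    using tv_dist_walk_dist_tendsto_0[OF assms(1-3)] assms(4) by (rule order_tendstoD)
  then obtain t where
    "tv_dist (walk_states G n) (walk_dist G n t) (pmf_of_set (walk_states G n)) \<le> \<epsilon>"
    using eventually_happens'[OF sequentially_bot] less_imp_le by blast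
  thus ?thesis
    unfolding mixing_time_def by (rule LeastI)
qed

section \<open>Lower bounds on the mixing time\<close>

lemma walk_eigenvalue_power_mixing_time_le:
  assumes "n \<ge> 1" "1 \<in> G ` {1..n}" "\<epsilon> > 0" "0 < k" "k < G n"
  shows "norm (walk_eigenvalue G n k) ^ mixing_time G n \<epsilon> \<le> 2 * \<epsilon>"
proof -
  let ?t = "mixing_time G n \<epsilon>"
  have "norm (walk_eigenvalue G n k) ^ ?t = norm (fourier_coeff (G n) (walk_dist G n ?t) k)"
    using assms by (simp add: fourier_coeff_walk_dist norm_power)
  also have "\<dots> \<le> 2 * tv_dist {0..<G n} (walk_dist G n ?t) (pmf_of_set {0..<G n})"
    using assms by (intro norm_fourier_coeff_le_tv_dist set_pmf_walk_dist) auto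
  also have "\<dots> \<le> 2 * \<epsilon>"
    using tv_dist_mixing_time_le[of n G \<epsilon>] assms by (simp add: walk_states_def)
  finally show ?thesis .
qed

text \<open>
  With \<open>a\<close> as the relaxation time, this is the usual passage from a spectral bound to a bound on
  the time. It rests on \<open>ln y \<le> y - 1\<close> at \<open>y = 1 / (1 - 1 / a)\<close>, where the right-hand side is
  \<open>1 / (a - 1)\<close>. For \<open>a = 1\<close> the base of the power is \<open>0\<close>, but then the factor \<open>a - 1\<close> vanishes.
\<close>

lemma relaxation_time_bound:
  fixes a \<epsilon> :: real
  assumes "a \<ge> 1" "\<epsilon> > 0" "(1 - 1 / a) ^ t \<le> 2 * \<epsilon>"
  shows "(a - 1) * ln (1 / (2 * \<epsilon>)) \<le> real t"
proof (cases "a = 1")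
  case False
  hence a: "a > 1" and r: "1 - 1 / a > 0"
    using assms(1) by (auto simp: field_simps)
  have "ln ((1 - 1 / a) ^ t) \<le> ln (2 * \<epsilon>)"
    using assms r by (subst ln_le_cancel_iff) auto
  hence "ln (1 / (2 * \<epsilon>)) \<le> real t * ln (1 / (1 - 1 / a))"
    using r a assms(2) by (simp add: ln_realpow ln_div)
  also have "\<dots> \<le> real t * (1 / (1 - 1 / a) - 1)"
    using r by (intro mult_left_mono ln_le_minus_one) auto
  also have "1 / (1 - 1 / a) - 1 = 1 / (a - 1)"
    using a by (simp add: field_simps)
  finally show ?thesis
    using a by (simp add: field_simps)
qed simp

text \<open>
  The index \<open>c ^ (n - 2)\<close> makes the root of unity have order \<open>c\<close>. All increments \<open>c ^ j\<close> with
  \<open>j > 0\<close> are then invisible to the character, and only the increment \<open>1\<close> pulls the average away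
  from \<open>1\<close>.
\<close>

lemma Re_walk_eigenvalue_powers:
  fixes c n :: nat
  assumes "c > 1" "n \<ge> 2"
  shows "Re (walk_eigenvalue (\<lambda>k. c ^ (k - 1)) n (c ^ (n - 2)))
       = 1 - (1 - cos (2 * pi / real c)) / real n"
proof -
  let ?G = "\<lambda>k. c ^ (k - 1) :: nat"
  let ?S = "?G ` {1..n}"
  define w where "w = unity_root (c ^ (n - 1)) (c ^ (n - 2))"
  have inj: "inj_on ?G {1..n}"
    using assms by (auto simp: inj_on_def)
  have card: "card ?S = n"
    using inj by (simp add: card_image)
  have "n - 1 = Suc (n - 2)"
    using assms by simp
  hence w: "w = cis (2 * pi / real c)"
    using assms unfolding w_def unity_root_def by simp
  have "w ^ c = 1"
    using assms by (simp add: w Complex.DeMoivre)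
  hence w1: "w ^ z = 1" if "c dvd z" for z
    using that by (auto simp: power_mult elim!: dvdE)
  have one: "1 \<in> ?S"
    using assms by (auto intro!: image_eqI[of _ _ 1])
  have dvd: "c dvd z" if "z \<in> ?S - {1}" for z
  proof -
    from that obtain j where "z = c ^ (j - 1)" "j - 1 \<noteq> 0"
      by (auto simp del: diff_is_0_eq diff_is_0_eq')
    thus ?thesis
      by simp
  qed
  have "(\<Sum>z\<in>?S. w ^ z) = w ^ 1 + (\<Sum>z\<in>?S - {1}. w ^ z)"
    using one by (intro sum.remove) auto
  also have "(\<Sum>z\<in>?S - {1}. w ^ z) = of_nat (n - 1)"
    using one card by (simp add: w1 dvd card_Diff_singleton)
  finally have "walk_eigenvalue ?G n (c ^ (n - 2)) = (w + of_nat (n - 1)) / of_nat n"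
    unfolding walk_eigenvalue_def card w_def[symmetric] by simp
  also have "Re \<dots> = (cos (2 * pi / real c) + (real n - 1)) / real n"
    using assms by (simp add: w of_nat_diff)
  also have "\<dots> = 1 - (1 - cos (2 * pi / real c)) / real n"
    using assms by (simp add: field_simps)
  finally show ?thesis .
qed

theorem theorem4p5:
  fixes c n :: nat and \<epsilon> \<gamma> :: real
  assumes "c > 1" and "n \<ge> 2" and "\<epsilon> > 0"
    and "\<gamma> = 1 / (1 - cos (2 * pi / real c))"
  shows "real (mixing_time (\<lambda>k. c ^ (k - 1)) n \<epsilon>) \<ge> (\<gamma> * real n - 1) * ln (1 / (2 * \<epsilon>))"
proof -
  let ?G = "\<lambda>k. c ^ (k - 1) :: nat"
  let ?t = "mixing_time ?G n \<epsilon>" and ?d = "1 - cos (2 * pi / real c)"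
  let ?ev = "walk_eigenvalue ?G n (c ^ (n - 2))"
  have "unity_root c 1 \<noteq> 1"
    using assms(1) by (intro unity_root_neq_1) auto
  hence "cos (2 * pi / real c) \<noteq> 1"
    using sin_cos_squared_add[of "2 * pi / real c"]
    by (auto simp: unity_root_def complex_eq_iff simp del: sin_cos_squared_add)
  hence d: "?d > 0"
    using cos_le_one[of "2 * pi / real c"] by linarith
  (* The bound d <= 2 <= n makes the base 1 - d / n nonnegative, as taking powers requires. *)
  have "?d \<le> real n"
    using cos_ge_minus_one[of "2 * pi / real c"] assms(2) by linarith
  hence a: "\<gamma> * real n \<ge> 1"
    using d by (simp add: assms(4))
  have "1 - 1 / (\<gamma> * real n) = Re ?ev"
    unfolding Re_walk_eigenvalue_powers[OF assms(1,2)] by (simp add: assms(4))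
  also have "\<dots> \<le> norm ?ev"
    by (rule complex_Re_le_cmod)
  finally have "(1 - 1 / (\<gamma> * real n)) ^ ?t \<le> norm ?ev ^ ?t"
    using a by (intro power_mono) auto
  also have "\<dots> \<le> 2 * \<epsilon>"
  proof (rule walk_eigenvalue_power_mixing_time_le)
    show "1 \<in> ?G ` {1..n}"
      using assms by (auto intro!: image_eqI[of _ _ 1])
  qed (use assms in auto)
  finally show ?thesis
    by (rule relaxation_time_bound[OF a assms(3)])
qed

end
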